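(* Let $r \geq 5$ be an odd integer and let $k$ be an integer with $2k \geq r+5$. For every integer $n \geq 2kr$, \[ \textup{sat}(n, C_r, C_{2k}) = 0, \] i.e., there exists an $n$-vertex $C_{2k}$-saturated graph containing no cycle of length $r$ as a subgraph.
   Context: All graphs are finite and simple; $C_m$ denotes the cycle of length $m$. For a graph $F$, a graph $G$ is $F$-saturated if $G$ does not contain $F$ as a subgraph, but adding any edge between two nonadjacent vertices of $G$ creates a copy of $F$. For graphs $H$ and $F$, $\textup{sat}(n,H,F)$ denotes the minimum number of copies of $H$ (as subgraphs) in an $n$-vertex $F$-saturated graph. *)

theory Defs
  imports Main "HOL-Library.Extended_Nat"
begin

text \<open>A graph is a pair of a vertex set and a set of edges, an edge being an unordered pair of
  distinct vertices.\<close>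

type_synonym 'a ugraph = "'a set \<times> 'a set set"

abbreviation verts :: "'a ugraph \<Rightarrow> 'a set" where
  "verts G \<equiv> fst G"

abbreviation edges :: "'a ugraph \<Rightarrow> 'a set set" where
  "edges G \<equiv> snd G"

definition simple_graph :: "'a ugraph \<Rightarrow> bool" where
  "simple_graph G \<longleftrightarrow> finite (verts G) \<and> (\<forall>e\<in>edges G. e \<subseteq> verts G \<and> card e = 2)"

definition subgraph_of :: "'a ugraph \<Rightarrow> 'a ugraph \<Rightarrow> bool" where
  "subgraph_of S G \<longleftrightarrow> simple_graph S \<and> verts S \<subseteq> verts G \<and> edges S \<subseteq> edges G"

definition graph_iso :: "'a ugraph \<Rightarrow> 'b ugraph \<Rightarrow> bool" where
  "graph_iso G H \<longleftrightarrow>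
     (\<exists>f. bij_betw f (verts G) (verts H) \<and>
          (\<forall>u\<in>verts G. \<forall>v\<in>verts G. {u, v} \<in> edges G \<longleftrightarrow> {f u, f v} \<in> edges H))"

text \<open>Copies are not necessarily induced, and they are counted as subgraphs, not as embeddings.\<close>

definition copies :: "'b ugraph \<Rightarrow> 'a ugraph \<Rightarrow> 'a ugraph set" where
  "copies H G = {S. subgraph_of S G \<and> graph_iso S H}"

definition contains_copy :: "'a ugraph \<Rightarrow> 'b ugraph \<Rightarrow> bool" where
  "contains_copy G H \<longleftrightarrow> (\<exists>S. subgraph_of S G \<and> graph_iso S H)"

definition add_edge :: "'a \<Rightarrow> 'a \<Rightarrow> 'a ugraph \<Rightarrow> 'a ugraph" where
  "add_edge u v G = (verts G, insert {u, v} (edges G))"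

definition saturated :: "'b ugraph \<Rightarrow> 'a ugraph \<Rightarrow> bool" where
  "saturated F G \<longleftrightarrow>
     \<not> contains_copy G F \<and>
     (\<forall>u\<in>verts G. \<forall>v\<in>verts G. u \<noteq> v \<longrightarrow> {u, v} \<notin> edges G \<longrightarrow>
        contains_copy (add_edge u v G) F)"

text \<open>Every finite graph is isomorphic to one whose vertices are natural numbers, so it suffices
  to minimise over those. The infimum is taken in \<^typ>\<open>enat\<close>: it is attained whenever some
  \<open>n\<close>-vertex \<open>F\<close>-saturated graph exists, and it is \<open>\<infinity>\<close> (rather than a spurious \<open>0\<close>) otherwise.\<close>

definition sat :: "nat \<Rightarrow> 'b ugraph \<Rightarrow> 'c ugraph \<Rightarrow> enat" where
  "sat n H F =
     Inf {enat (card (copies H G)) | G :: nat ugraph.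
            simple_graph G \<and> card (verts G) = n \<and> saturated F G}"

text \<open>This is the cycle of length \<open>m\<close> only for \<open>m \<ge> 3\<close>.\<close>

definition cycle_graph :: "nat \<Rightarrow> nat ugraph" where
  "cycle_graph m = ({0..<m}, {{i, (i + 1) mod m} | i. i < m})"

end

theory Submission
  imports Defs
begin

text \<open>Write \<open>r = 2 t - 1\<close>. Take a chain of \<open>t\<close> complete bipartite blocks with sides \<open>A\<^sub>i\<close> of size
  \<open>k - 1\<close> and large \<open>B\<^sub>i\<close>, where consecutive blocks share a vertex of \<open>B\<^sub>i \<inter> B\<^sub>i\<^sub>+\<^sub>1\<close>, and close it by
  one edge between the two ends. The graph maps homomorphically to the cycle of length \<open>r + 2\<close>, so
  it has no cycle of length \<open>r\<close>. An even cycle avoids the closing edge, hence stays inside one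
  block, where \<open>\<bar>A\<^sub>i\<bar> = k - 1\<close> forbids length \<open>2 k\<close>. Conversely any two nonadjacent vertices are
  joined by a path of odd length at most \<open>r + 4 \<le> 2 k - 1\<close> (through the closing edge if they are in
  the same colour class of the chain), and detours inside a single block lengthen it two by two to
  \<open>2 k - 1\<close>.\<close>

subsection \<open>Cycles as periodic walks and as closed-up paths\<close>

text \<open>Indexing the cycle by all naturals, with period \<open>m\<close>, spares a separate
  treatment of the edge from the last vertex back to the first.\<close>

lemma contains_copy_cycleD:
  assumes "contains_copy G (cycle_graph m)" and "m > 0"
  obtains W where "\<And>i. W (i + m) = W i" and "inj_on W {..<m}"
    and "\<And>i. {W i, W (Suc i)} \<in> edges G"
proof -
  obtain S f where S: "subgraph_of S G" and f: "bij_betw f (verts S) {0..<m}"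
    and iso: "\<And>u v. u \<in> verts S \<Longrightarrow> v \<in> verts S \<Longrightarrow>
      {u, v} \<in> edges S \<longleftrightarrow> {f u, f v} \<in> {{i, (i + 1) mod m} | i. i < m}"
    using assms(1) unfolding contains_copy_def graph_iso_def cycle_graph_def by auto
  define g where "g = inv_into (verts S) f"
  have g: "g i \<in> verts S" "f (g i) = i" if "i < m" for i
    using f that unfolding g_def
    by (auto simp: bij_betw_def inv_into_into f_inv_into_f)
  show ?thesis
  proof
    show "g ((i + m) mod m) = g (i mod m)" for i by simp
    show "inj_on (\<lambda>i. g (i mod m)) {..<m}"
      by (rule inj_on_inverseI[where g = f]) (auto simp: g)
    show "{g (i mod m), g (Suc i mod m)} \<in> edges G" for i
    proof -
      have "{i mod m, Suc i mod m} \<in> {{i, (i + 1) mod m} | i. i < m}"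
        using assms(2) by (auto simp: mod_Suc_eq intro!: exI[of _ "i mod m"])
      then have "{g (i mod m), g (Suc i mod m)} \<in> edges S"
        using iso[of "g (i mod m)" "g (Suc i mod m)"] g assms(2) by simp
      then show ?thesis using S by (auto simp: subgraph_of_def)
    qed
  qed
qed

text \<open>This turns a path joining a nonadjacent pair into the cycle closed by the added
  edge.\<close>

lemma contains_copy_cycleI:
  assumes "distinct xs" and "set xs \<subseteq> verts G" and "length xs \<ge> 3"
    and "successively (\<lambda>x y. {x, y} \<in> edges G) xs" and "{last xs, hd xs} \<in> edges G"
  shows "contains_copy G (cycle_graph (length xs))"
proof -
  define m where "m = length xs"
  define S where "S = (set xs, {{xs ! i, xs ! ((i + 1) mod m)} | i. i < m})"
  have m: "m \<ge> 3" using assms(3) m_def by simp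
  have edge: "{xs ! i, xs ! ((i + 1) mod m)} \<in> edges G" if "i < m" for i
  proof (cases "Suc i = m")
    case True
    then have "last xs = xs ! i" "hd xs = xs ! ((i + 1) mod m)"
      using assms(3) by (auto simp: m_def last_conv_nth hd_conv_nth
          simp flip: length_greater_0_conv dest: sym)
    then show ?thesis using assms(5) by simp
  next
    case False
    with that have "Suc i < length xs" "(i + 1) mod m = Suc i" by (auto simp: m_def)
    then show ?thesis using assms(4) by (simp add: successively_conv_nth)
  qed
  have ne: "xs ! i \<noteq> xs ! ((i + 1) mod m)" if "i < m" for i
  proof -
    have "(i + 1) mod m \<noteq> i" "(i + 1) mod m < m"
      using that m by (cases "Suc i = m"; auto)+
    then show ?thesis using assms(1) that
      by (metis m_def nth_eq_iff_index_eq)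
  qed
  have sub: "subgraph_of S G"
    unfolding subgraph_of_def simple_graph_def S_def using edge ne assms(2) m
    by (auto simp: m_def intro!: nth_mem mod_less_divisor)
  have inj: "inj_on ((!) xs) {0..<m}"
    using assms(1) by (auto simp: inj_on_def m_def nth_eq_iff_index_eq)
  have bij: "bij_betw ((!) xs) {0..<m} (set xs)"
    using inj by (auto simp: bij_betw_def m_def set_conv_nth)
  define f where "f = inv_into {0..<m} ((!) xs)"
  have f: "f (xs ! i) = i" if "i < m" for i
    using inj that unfolding f_def by (simp add: inv_into_f_f)
  have "{u, v} \<in> edges S \<longleftrightarrow> {f u, f v} \<in> edges (cycle_graph m)"
    if uv: "u \<in> set xs" "v \<in> set xs" for u v
  proof -
    obtain a b where ab: "a < m" "u = xs ! a" "b < m" "v = xs ! b"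
      using uv unfolding m_def in_set_conv_nth by blast
    \<comment> \<open>As \<open>(!) xs\<close> is injective on the indices, edges can be compared
      through their index pairs.\<close>
    have "{xs ! a, xs ! b} = {xs ! i, xs ! ((i + 1) mod m)} \<longleftrightarrow> {a, b} = {i, (i + 1) mod m}"
      if "i < m" for i
      using inj_on_image_eq_iff[OF inj, of "{a, b}" "{i, (i + 1) mod m}"] ab(1,3) that m
      by simp
    then have "{xs ! a, xs ! b} \<in> edges S \<longleftrightarrow> {a, b} \<in> edges (cycle_graph m)"
      unfolding S_def cycle_graph_def snd_conv mem_Collect_eq by blast
    then show ?thesis by (simp add: ab f)
  qed
  moreover have "bij_betw f (verts S) (verts (cycle_graph m))"
    using bij_betw_inv_into[OF bij] by (simp add: f_def S_def cycle_graph_def)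
  ultimately have "graph_iso S (cycle_graph m)"
    unfolding graph_iso_def by (intro exI[of _ f]) (simp add: S_def)
  then show ?thesis using sub m_def unfolding contains_copy_def by blast
qed

lemma even_card_changes:
  fixes g :: "nat \<Rightarrow> bool"
  shows "even (card {i. i < m \<and> g i \<noteq> g (Suc i)}) \<longleftrightarrow> g 0 = g m"
proof (induction m)
  case (Suc m)
  have "{i. i < Suc m \<and> g i \<noteq> g (Suc i)} =
      (if g m \<noteq> g (Suc m) then insert m {i. i < m \<and> g i \<noteq> g (Suc i)}
       else {i. i < m \<and> g i \<noteq> g (Suc i)})"
    by (auto simp: less_Suc_eq)
  then show ?case using Suc by auto
qed simp

text \<open>Flipping the colour at every second index exchanges repeats and changes, and since
  \<open>m\<close> is even the two ends still agree afterwards. Read on a cycle, this counts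
  monochromatic edges.\<close>

lemma even_card_repeats:
  fixes g :: "nat \<Rightarrow> bool"
  assumes "even m" and "g m = g 0"
  shows "even (card {i. i < m \<and> g i = g (Suc i)})"
proof -
  let ?h = "\<lambda>i. g i \<noteq> even i"
  have "{i. i < m \<and> g i = g (Suc i)} = {i. i < m \<and> ?h i \<noteq> ?h (Suc i)}" by auto
  then show ?thesis using even_card_changes[of m ?h] assms by simp
qed

subsection \<open>The closed chain of complete bipartite graphs\<close>

text \<open>With \<open>N = 2 t + 1\<close>, the residue \<open>v mod N\<close> is the position of \<open>v\<close> around the chain: the residue
  class of \<open>2 i + 1\<close> is \<open>A\<^sub>i\<close>, and \<open>B\<^sub>i\<close> is the class of \<open>2 i\<close> together with the number \<open>2 i + 2\<close>
  itself. So the numbers \<open>0, 2, \<dots>, 2 t\<close> are the cut vertices and ends of the chain, and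
  \<open>0, 1, \<dots>, 2 t\<close> is a spine running through it. The even classes below \<open>2 t\<close> are bounded only from
  below, which leaves room for any number of vertices.\<close>

locale closed_chain =
  fixes t k :: nat and N :: nat and V :: "nat set"
  defines "N \<equiv> 2 * t + 1"
  assumes t: "t \<ge> 3" and k: "k \<ge> t + 2" and fin: "finite V"
    and odd_class: "\<And>v. odd (v mod N) \<Longrightarrow> v \<in> V \<longleftrightarrow> v div N < k - 1"
    and even_class: "\<And>v. even (v mod N) \<Longrightarrow> v mod N < 2 * t \<Longrightarrow> v div N < 2 * k \<Longrightarrow> v \<in> V"
    and last_class: "\<And>v. v mod N = 2 * t \<Longrightarrow> v \<in> V \<longleftrightarrow> v = 2 * t"
begin

text \<open>Oriented from the side of size \<open>k - 1\<close> to the other side of a block. The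
  second disjunct compares the number \<open>y\<close> itself, so of the next even class only the
  spine vertex is reached.\<close>

definition link :: "nat \<Rightarrow> nat \<Rightarrow> bool" where
  "link x y \<longleftrightarrow> odd (x mod N) \<and> (y mod N + 1 = x mod N \<or> y = x mod N + 1)"

definition closing :: "nat \<Rightarrow> nat \<Rightarrow> bool" where
  "closing x y \<longleftrightarrow> x = 0 \<and> y = 2 * t \<or> x = 2 * t \<and> y = 0"

definition adj :: "nat \<Rightarrow> nat \<Rightarrow> bool" where
  "adj x y \<longleftrightarrow> link x y \<or> link y x \<or> closing x y"

definition chain :: "nat ugraph" where
  "chain = (V, {{u, v} | u v. u \<in> V \<and> v \<in> V \<and> adj u v})"

lemma N_pos [simp]: "N > 0" and N_eq: "N = 2 * t + 1"
  by (simp_all add: N_def)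

lemma mod_le: "x mod N \<le> 2 * t"
  using mod_less_divisor[of N x] by (simp add: N_eq del: mod_less_divisor)

lemma mod_spine: "x \<le> 2 * t \<Longrightarrow> x mod N = x"
  by (simp add: N_eq)

lemma adj_sym: "adj x y \<longleftrightarrow> adj y x"
  by (auto simp: adj_def closing_def)

lemma link_even: "link x y \<Longrightarrow> even (y mod N)"
  using mod_le[of x] mod_spine[of "x mod N + 1"] unfolding link_def
  by (metis even_plus_one_iff le_antisym not_less_eq_eq Suc_eq_plus1 even_mult_iff even_numeral)

lemma link_neq: "link x y \<Longrightarrow> x \<noteq> y"
  using link_even link_def by blast

lemma adj_neq: "adj x y \<Longrightarrow> x \<noteq> y"
  using link_neq t by (auto simp: adj_def closing_def)

text \<open>The parity of the residue properly 2-colours the chain, whereas the two ends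
  \<open>0\<close> and \<open>2 * t\<close> both have even residue.\<close>

lemma closing_iff_same_parity:
  assumes "adj x y"
  shows "closing x y \<longleftrightarrow> odd (x mod N) = odd (y mod N)"
proof (cases "closing x y")
  case True
  then show ?thesis using mod_spine[of "2 * t"] by (auto simp: closing_def)
next
  case False
  then show ?thesis using assms link_even unfolding adj_def link_def by metis
qed

lemma edge_iff: "{x, y} \<in> edges chain \<longleftrightarrow> x \<in> V \<and> y \<in> V \<and> adj x y"
  unfolding chain_def snd_conv mem_Collect_eq doubleton_eq_iff using adj_sym by blast

lemma simple_chain: "simple_graph chain"
  using fin adj_neq by (auto simp: simple_graph_def chain_def card_insert_if)

lemma spine_V: "x \<le> 2 * t \<Longrightarrow> x \<in> V"
proof -
  assume x: "x \<le> 2 * t"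
  then have "x mod N = x" "x div N = 0" by (auto simp: N_eq)
  then show ?thesis
    using odd_class[of x] even_class[of x] last_class[of x] k x
    by (cases "x = 2 * t"; cases "odd x") auto
qed

section \<open>Excluding cycles of lengths \<open>2 * t - 1\<close> and \<open>2 * k\<close>\<close>

lemma link_mod:
  assumes "link x y"
  shows "y mod N + 1 = x mod N \<or> y mod N = x mod N + 1 \<and> y = x mod N + 1"
proof -
  have "x mod N < 2 * t"
    using assms mod_le[of x] by (auto simp: link_def le_less)
  then show ?thesis using assms by (auto simp: link_def N_eq)
qed

text \<open>The residue modulo \<open>N\<close> is a homomorphism onto the cycle of length \<open>N\<close>.\<close>

lemma adj_residue:
  assumes "adj x y"
  shows "\<exists>s::int. \<bar>s\<bar> = 1 \<and> int N dvd int (y mod N) - int (x mod N) - s"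
proof -
  consider "y mod N + 1 = x mod N" | "x mod N + 1 = y mod N" | "x = 0" "y = 2 * t" | "x = 2 * t" "y = 0"
    using assms link_mod unfolding adj_def closing_def by (metis Suc_eq_plus1)
  then show ?thesis
  proof cases
    case 1
    then have "int (y mod N) - int (x mod N) - (-1) = 0" by linarith
    then show ?thesis by (intro exI[of _ "-1"]) simp
  next
    case 2
    then have "int (y mod N) - int (x mod N) - 1 = 0" by linarith
    then show ?thesis by (intro exI[of _ "1"]) simp
  next
    \<comment> \<open>Modulo \<open>N\<close> the position \<open>2 * t\<close> is
      \<open>-1\<close>, so the closing edge is a unit step as well.\<close>
    case 3 then show ?thesis by (intro exI[of _ "-1"]) (simp add: N_eq algebra_simps)
  next
    case 4
    then have "int (y mod N) - int (x mod N) - 1 = - int N" by (auto simp: N_eq)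
    then show ?thesis by (intro exI[of _ "1"]) auto
  qed
qed

text \<open>The signed steps of a closed walk add up to a multiple of \<open>N\<close>. With fewer
  than \<open>N\<close> steps the sum is \<open>0\<close>, but it has the parity of the number of
  steps, which is odd.\<close>

lemma no_short_odd_cycle: "\<not> contains_copy chain (cycle_graph (2 * t - 1))"
proof
  let ?m = "2 * t - 1"
  assume "contains_copy chain (cycle_graph ?m)"
  then obtain W where per: "\<And>i. W (i + ?m) = W i"
    and E: "\<And>i. {W i, W (Suc i)} \<in> edges chain"
    by (rule contains_copy_cycleD) (use t in auto)
  have "\<exists>s::int. \<bar>s\<bar> \<le> int i \<and> even (s - int i) \<and> int N dvd int (W i mod N) - int (W 0 mod N) - s" for i
  proof (induction i)
    case (Suc i)
    then obtain s :: int where s: "\<bar>s\<bar> \<le> int i" "even (s - int i)"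
      "int N dvd int (W i mod N) - int (W 0 mod N) - s" by blast
    obtain s' :: int where s': "\<bar>s'\<bar> = 1" "int N dvd int (W (Suc i) mod N) - int (W i mod N) - s'"
      using adj_residue E edge_iff by meson
    have "int N dvd int (W (Suc i) mod N) - int (W 0 mod N) - (s + s')"
      using dvd_add[OF s(3) s'(2)] by (simp add: algebra_simps)
    moreover have "\<bar>s + s'\<bar> \<le> int (Suc i)" "even (s + s' - int (Suc i))"
      using s s'(1) by (auto simp: abs_if split: if_splits)
    ultimately show ?case by blast
  qed (auto intro: exI[of _ 0])
  from this[of ?m] obtain s :: int where s: "\<bar>s\<bar> \<le> int ?m" "even (s - int ?m)" "int N dvd - s"
    using per[of 0] by auto
  then have "s = 0"
    using dvd_imp_le_int[of s "int N"] t by (fastforce simp: N_eq)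
  with s(2) t show False by auto
qed

text \<open>Once the closing edge and every passage from one block to another are excluded, every
  second vertex of the cycle lies in one and the same odd class. That class has only
  \<open>k - 1\<close> vertices.\<close>

lemma no_even_cycle: "\<not> contains_copy chain (cycle_graph (2 * k))"
proof
  let ?m = "2 * k"
  assume "contains_copy chain (cycle_graph ?m)"
  then obtain W where per: "\<And>i. W (i + ?m) = W i" and inj: "inj_on W {..<?m}"
    and E: "\<And>i. {W i, W (Suc i)} \<in> edges chain"
    by (rule contains_copy_cycleD) (use k in auto)
  have adj: "adj (W i) (W (Suc i))" and WV: "W i \<in> V" for i
    using E edge_iff by blast+
  have per_mod: "W (i mod ?m) = W i" for i
  proof -
    have "W (j + q * ?m) = W j" for j q
    proof (induction q)
      case (Suc q)
      then show ?case using per[of "j + q * ?m"] by (simp add: algebra_simps)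
    qed simp
    from this[of "i mod ?m" "i div ?m"] show ?thesis by (simp only: mod_div_mult_eq)
  qed
  have W_eq: "W i = W j \<longleftrightarrow> i mod ?m = j mod ?m" for i j
    proof
    have "i mod ?m < ?m" "j mod ?m < ?m" using k by simp_all
    moreover assume "W i = W j"
    then have "W (i mod ?m) = W (j mod ?m)" by (simp only: per_mod)
    ultimately show "i mod ?m = j mod ?m" using inj_onD[OF inj] by blast
  qed (metis per_mod)
  \<comment> \<open>Every 2-colouring leaves an even number of edges of an even cycle monochromatic. It is applied
    to the colouring by parity, and to its flips beyond a cut vertex \<open>y\<close>, whose monochromatic edges
    are those joining \<open>y\<close> to the block before it.\<close>
  have not_single: False
    if "\<And>j. (f (W j) = f (W (Suc j))) \<longleftrightarrow> j mod ?m = i mod ?m" for i and f :: "nat \<Rightarrow> bool"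
  proof -
    have "{j. j < ?m \<and> f (W j) = f (W (Suc j))} = {i mod ?m}"
    proof -
      have "0 < ?m" using k by simp
      then have "j < ?m \<and> j mod ?m = i mod ?m \<longleftrightarrow> j = i mod ?m" for j
        by (metis mod_less mod_less_divisor)
      then show ?thesis unfolding that by blast
    qed
    then have "card {j. j < ?m \<and> f (W j) = f (W (Suc j))} = 1" by simp
    moreover have "W ?m = W 0" using per[of 0] by (simp only: add_0)
    ultimately show False
      using even_card_repeats[of ?m "\<lambda>j. f (W j)"] by (metis dvd_triv_left odd_one)
  qed
  have no_closing: "\<not> closing (W i) (W (Suc i))" for i
  proof
    assume i: "closing (W i) (W (Suc i))"
    show False
    proof (rule not_single[of "\<lambda>x. odd (x mod N)" i])
      fix j
      have "closing (W j) (W (Suc j)) \<longleftrightarrow> j mod ?m = i mod ?m"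
      proof
        assume "closing (W j) (W (Suc j))"
        with i consider "W j = W i" | "W j = W (Suc i)" "W (Suc j) = W i"
          unfolding closing_def by metis
        then show "j mod ?m = i mod ?m"
        proof cases
          case 1
          then show ?thesis by (simp only: W_eq)
        next
          case 2
          then have "j mod ?m = Suc i mod ?m" "Suc j mod ?m = i mod ?m"
            by (simp_all only: W_eq)
          \<comment> \<open>Using the closing edge in both directions would bring the cycle back
            after two steps.\<close>
          then have "Suc (Suc i) mod ?m = i mod ?m"
            by (metis mod_Suc_eq)
          then have "?m dvd Suc (Suc i) - i"
            using mod_eq_dvd_iff_nat[of i "Suc (Suc i)" ?m] by simp
          then have "?m \<le> 2" by (auto dest: dvd_imp_le)
          then show ?thesis using k t by linarith
        qed
      next
        assume "j mod ?m = i mod ?m"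
        then have "W j = W i" "W (Suc j) = W (Suc i)"
          unfolding W_eq by (assumption, metis mod_Suc_eq)
        then show "closing (W j) (W (Suc j))" using i by simp
      qed
      then show "odd (W j mod N) = odd (W (Suc j) mod N) \<longleftrightarrow> j mod ?m = i mod ?m"
        using closing_iff_same_parity[OF adj] by blast
    qed
  qed
  have step: "link (W i) (W (Suc i)) \<or> link (W (Suc i)) (W i)" for i
    using adj no_closing unfolding adj_def by blast
  have alt: "odd (W (Suc i) mod N) \<longleftrightarrow> even (W i mod N)" for i
    using closing_iff_same_parity[OF adj] no_closing by blast
  have same_block: "W (Suc (Suc i)) mod N = W i mod N" if "odd (W i mod N)" for i
  proof (rule ccontr)
    define a y b where "a = W i" and "y = W (Suc i)" and "b = W (Suc (Suc i))"
    assume "W (Suc (Suc i)) mod N \<noteq> W i mod N"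
    then have ne: "b mod N \<noteq> a mod N" by (simp add: a_def b_def)
    have odd: "odd (a mod N)" "even (y mod N)" "odd (b mod N)"
      using that alt[of i] alt[of "Suc i"] by (simp_all add: a_def y_def b_def)
    have link: "link a y" "link b y"
      using step[of i] step[of "Suc i"] odd link_even unfolding a_def y_def b_def by blast+
    \<comment> \<open>From two different classes \<open>y\<close> cannot be reached downwards both
      times, so it is the upper spine vertex of one of the two blocks.\<close>
    then have y: "y = a mod N + 1 \<or> y = b mod N + 1"
      using ne by (auto simp: link_def)
    then have "y \<le> 2 * t"
      using mod_le[of a] mod_le[of b] odd by (metis Suc_eq_plus1 even_mult_iff even_numeral le_neq_implies_less less_eq_Suc_le)
    then have ymod: "y mod N = y" by (rule mod_spine)
    define f where "f x \<longleftrightarrow> odd (x mod N) \<noteq> (y \<le> x mod N)" for x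
    have f_link: "f x = f z \<longleftrightarrow> z = y \<and> x mod N + 1 = y" if "link x z" for x z
    proof -
      have parity: "odd (x mod N)" "even (z mod N)"
        using that link_even by (auto simp: link_def)
      then have "x mod N \<noteq> y" using odd(2) ymod by auto
      moreover have "z = y \<Longrightarrow> z mod N = y" using ymod by simp
      moreover have "z mod N + 1 = x mod N \<or> z mod N = x mod N + 1 \<and> z = x mod N + 1"
        using link_mod that .
      ultimately show ?thesis unfolding f_def using parity by linarith
    qed
    have f_step: "f (W j) = f (W (Suc j)) \<longleftrightarrow>
        W (Suc j) = y \<and> W j mod N + 1 = y \<or> W j = y \<and> W (Suc j) mod N + 1 = y" for j
    proof -
      have "odd (W (Suc j) mod N) \<or> odd (W j mod N)" using alt[of j] by blast
      then show ?thesis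
        using step[of j] f_link[of "W j" "W (Suc j)"] f_link[of "W (Suc j)" "W j"] ymod odd(2)
          link_even[of "W j" "W (Suc j)"] link_even[of "W (Suc j)" "W j"] by metis
    qed
    have at_y: "W j = y \<longleftrightarrow> j mod ?m = Suc i mod ?m" for j
      unfolding y_def by (rule W_eq)
    have succ_at_y: "W (Suc j) = y \<longleftrightarrow> j mod ?m = i mod ?m" for j
    proof
      assume "W (Suc j) = y"
      then have "(Suc j + (?m - 1)) mod ?m = (Suc i + (?m - 1)) mod ?m"
        unfolding at_y by (rule mod_add_cong) simp
      then show "j mod ?m = i mod ?m" using k by simp
    next
      assume "j mod ?m = i mod ?m"
      then show "W (Suc j) = y" unfolding at_y by (metis mod_Suc_eq)
    qed
    have Wj: "W j = a" if "j mod ?m = i mod ?m" for j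
      using that unfolding a_def by (simp only: W_eq)
    have WSj: "W (Suc j) = b" if "j mod ?m = Suc i mod ?m" for j
      using that unfolding b_def W_eq by (metis mod_Suc_eq)
    \<comment> \<open>Exactly one of the neighbours \<open>a\<close> and \<open>b\<close> lies in
      the block before \<open>y\<close>, so \<open>f\<close> leaves exactly one edge of the cycle
      monochromatic.\<close>
    show False
    proof (cases "y = a mod N + 1")
      case True
      then have "b mod N + 1 \<noteq> y" using ne by simp
      then show False
        using not_single[of f i] f_step at_y succ_at_y Wj WSj True by metis
    next
      case False
      then have "y = b mod N + 1" using y by blast
      then show False
        using not_single[of f "Suc i"] f_step at_y succ_at_y Wj WSj False by metis
    qed
  qed
  define i0 where "i0 = (if odd (W 0 mod N) then 0 else 1 :: nat)"
  have odd0: "odd (W i0 mod N)" using alt[of 0] by (simp add: i0_def)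
  have block: "W (i0 + 2 * j) mod N = W i0 mod N" for j
  proof (induction j)
    case (Suc j)
    then show ?case using same_block[of "i0 + 2 * j"] odd0 by simp
  qed simp
  \<comment> \<open>Within one residue class the quotient by \<open>N\<close> determines the vertex,
    so the cycle needs \<open>k\<close> distinct quotients while the class offers
    \<open>k - 1\<close>.\<close>
  have "inj_on (\<lambda>j. W (i0 + 2 * j) div N) {..<k}"
  proof (rule inj_onI)
    fix j j' assume j: "j \<in> {..<k}" "j' \<in> {..<k}"
      and "W (i0 + 2 * j) div N = W (i0 + 2 * j') div N"
    then have "W (i0 + 2 * j) = W (i0 + 2 * j')"
      using block by (metis div_mult_mod_eq)
    moreover have "i0 + 2 * j < ?m" "i0 + 2 * j' < ?m" using j by (auto simp: i0_def)
    ultimately show "j = j'" by (simp add: W_eq)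
  qed
  moreover have "(\<lambda>j. W (i0 + 2 * j) div N) ` {..<k} \<subseteq> {..<k - 1}"
  proof (rule image_subsetI)
    fix j
    have "odd (W (i0 + 2 * j) mod N)" using block odd0 by metis
    then show "W (i0 + 2 * j) div N \<in> {..<k - 1}"
      using odd_class WV unfolding lessThan_iff by blast
  qed
  ultimately have "card {..<k} \<le> card {..<k - 1}"
    by (rule card_inj_on_le) simp
  then show False using k by simp
qed

subsection \<open>Paths with prescribed ends\<close>

definition good_path :: "nat \<Rightarrow> nat \<Rightarrow> nat list \<Rightarrow> bool" where
  "good_path u v xs \<longleftrightarrow> xs \<noteq> [] \<and> hd xs = u \<and> last xs = v \<and> distinct xs \<and> set xs \<subseteq> V \<and>
     successively adj xs"

lemma extend_once:
  assumes path: "good_path u v xs" and p: "odd p" "x \<in> set xs" "x mod N = p"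
    and len: "even (length xs)" "length xs < 2 * k"
    and few: "2 * card (set xs \<inter> {y. y mod N = p}) + 2 \<le> length xs"
  obtains xs' where "good_path u v xs'" "x \<in> set xs'" "length xs' = length xs + 2"
    "2 * card (set xs' \<inter> {y. y mod N = p}) + 2 \<le> length xs'"
proof -
  have "p < 2 * t" using mod_le[of x] p by (metis even_mult_iff even_numeral le_neq_implies_less)
  then have "p < N" by (simp add: N_eq)
  then have N: "(p + j * N) mod N = p" "(p + j * N) div N = j"
    and N': "(p - 1 + j * N) mod N = p - 1" "(p - 1 + j * N) div N = j" for j
    by simp_all
  have fresh: "\<exists>j<M. q + j * N \<notin> set xs" if "card (set xs \<inter> {y. y mod N = q}) < M" "q < N" for q M
  proof (rule ccontr)
    assume "\<not> ?thesis"
    then have "(\<lambda>j. q + j * N) ` {..<M} \<subseteq> set xs \<inter> {y. y mod N = q}" using that by auto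
    then have "card ((\<lambda>j. q + j * N) ` {..<M}) \<le> card (set xs \<inter> {y. y mod N = q})"
      by (rule card_mono[rotated]) simp
    moreover have "inj_on (\<lambda>j. q + j * N) {..<M}"
      using N_pos by (auto simp: inj_on_def simp del: N_pos)
    ultimately show False using that by (simp add: card_image)
  qed
  \<comment> \<open>The length is even and below \<open>2 * k\<close>, hence at most
    \<open>2 * k - 2\<close>, and \<open>few\<close> leaves at most \<open>k - 2\<close> used
    vertices in the class.\<close>
  have "card (set xs \<inter> {y. y mod N = p}) < k - 1" using few len by presburger
  then obtain j where j: "j < k - 1" "p + j * N \<notin> set xs"
    using fresh[of p "k - 1"] \<open>p < N\<close> by blast
  \<comment> \<open>The path has fewer than \<open>2 * k\<close> vertices, so it cannot exhaust the
    \<open>2 * k\<close> vertices guaranteed by \<open>even_class\<close>.\<close>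
  have "card (set xs \<inter> {y. y mod N = p - 1}) < 2 * k"
    using len(2) card_length[of xs] card_mono[of "set xs" "set xs \<inter> {y. y mod N = p - 1}"] by force
  then obtain i where i: "i < 2 * k" "p - 1 + i * N \<notin> set xs"
    using fresh[of "p - 1" "2 * k"] \<open>p < N\<close> by (meson diff_le_self le_less_trans)
  define a b where "a = p + j * N" and "b = p - 1 + i * N"
  have ab: "a \<notin> set xs" "b \<notin> set xs" "a mod N = p" "b mod N + 1 = p"
    using i j N N' odd_pos[OF p(1)] by (simp_all add: a_def b_def)
  then have "a \<noteq> b" by auto
  have "a \<in> V" using odd_class[of a] p N j by (simp add: a_def)
  have "b \<in> V" using even_class[of b] p N' i \<open>p < 2 * t\<close> by (simp add: b_def)
  have adj_b: "adj b y" "adj y b" if "y mod N = p" for y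
    using that ab p by (auto simp: adj_def link_def)
  \<comment> \<open>Vertices of one odd class are twins: \<open>link\<close> sees only their
    residue, and the closing edge has even ends. So \<open>a\<close> may replace \<open>x\<close>
    next to \<open>z\<close>.\<close>
  have adj_a: "adj a z" "adj z a" if "y mod N = p" "adj y z \<or> adj z y" for y z
  proof -
    have "link y z"
      using that p link_even[of z y] mod_spine[of 0] mod_spine[of "2 * t"]
      by (auto simp: adj_def closing_def)
    then show "adj a z" "adj z a" using that ab by (auto simp: adj_def link_def)
  qed
  have succ: "successively adj xs" using path by (simp add: good_path_def)
  obtain ys zs where xs: "xs = ys @ x # zs" using p(2) by (meson split_list)
  show ?thesis
  proof (cases zs)
    case (Cons z zs')
    define xs' where "xs' = ys @ x # b # a # z # zs'"
    have "adj x z" using succ unfolding xs Cons by (simp add: successively_append_iff)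
    then have "good_path u v xs'"
      using path ab \<open>a \<in> V\<close> \<open>b \<in> V\<close> \<open>a \<noteq> b\<close> adj_b[of x] adj_b[of a] adj_a[of x z] p
      unfolding xs Cons xs'_def
      by (auto simp: good_path_def successively_append_iff hd_append)
    moreover have "set xs' \<inter> {y. y mod N = p} = insert a (set xs \<inter> {y. y mod N = p})"
      using ab unfolding xs Cons xs'_def by auto
    ultimately show ?thesis
      using that[of xs'] few ab unfolding xs Cons by (simp add: xs'_def)
  next
    case Nil
    then have "ys \<noteq> []" using len(1) xs by auto
    then obtain ys' z where ys: "ys = ys' @ [z]" by (metis rev_exhaust)
    define xs' where "xs' = ys' @ [z, a, b, x]"
    have "adj z x" using succ unfolding xs ys Nil by (simp add: successively_append_iff)
    then have "good_path u v xs'"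
      using path ab \<open>a \<in> V\<close> \<open>b \<in> V\<close> \<open>a \<noteq> b\<close> adj_b[of x] adj_b[of a] adj_a[of x z] p
      unfolding xs ys Nil xs'_def
      by (auto simp: good_path_def successively_append_iff hd_append)
    moreover have "set xs' \<inter> {y. y mod N = p} = insert a (set xs \<inter> {y. y mod N = p})"
      using ab unfolding xs ys Nil xs'_def by auto
    ultimately show ?thesis
      using that[of xs'] few ab unfolding xs ys Nil by (simp add: xs'_def)
  qed
qed

text \<open>The cardinality bound is an invariant of the detours, and it guarantees that the block still
  has an unused odd vertex as long as the path has fewer than \<open>2 k\<close> vertices.\<close>

definition extendable :: "nat list \<Rightarrow> bool" where
  "extendable xs \<longleftrightarrow> even (length xs) \<and> length xs \<le> 2 * k \<and>
     (\<exists>x\<in>set xs. odd (x mod N) \<and> 2 * card (set xs \<inter> {y. y mod N = x mod N}) + 2 \<le> length xs)"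

lemma extend_path:
  assumes "good_path u v xs" and "extendable xs"
  obtains xs' where "good_path u v xs'" and "length xs' = 2 * k"
proof -
  have "\<exists>xs'. good_path u v xs' \<and> length xs' = 2 * k"
    using assms
  proof (induction "2 * k - length xs" arbitrary: xs rule: less_induct)
    case less
    show ?case
    proof (cases "length xs = 2 * k")
      case False
      obtain x where x: "x \<in> set xs" "odd (x mod N)"
        "2 * card (set xs \<inter> {y. y mod N = x mod N}) + 2 \<le> length xs"
        and len: "even (length xs)" "length xs < 2 * k"
        using less(3) False by (auto simp: extendable_def)
      obtain xs' where xs': "good_path u v xs'" "x \<in> set xs'" "length xs' = length xs + 2"
        "2 * card (set xs' \<inter> {y. y mod N = x mod N}) + 2 \<le> length xs'"
        using extend_once[OF less(2) x(2,1) refl len x(3)] by blast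
      have "length xs + 2 \<le> 2 * k" using len by presburger
      then have "extendable xs'"
        using xs' x(2) len by (auto simp: extendable_def)
      then show ?thesis using less(1)[of xs'] xs' len by simp
    qed (use less in blast)
  qed
  then show ?thesis using that by blast
qed

text \<open>The paths built below meet the chosen odd class in one or two vertices, and the bound
  \<open>2 * card + 2\<close> then asks for four or six vertices.\<close>

lemma extendableI:
  assumes "even (length xs)" and "length xs \<le> 2 * k" and "x \<in> set xs" and "odd (x mod N)"
    and "\<And>z. z \<in> set xs \<Longrightarrow> z mod N = x mod N \<Longrightarrow> z \<in> {x, y}"
    and "x = y \<and> 4 \<le> length xs \<or> 6 \<le> length xs"
  shows "extendable xs"
proof -
  have "card (set xs \<inter> {z. z mod N = x mod N}) \<le> card {x, y}"
    using assms(5) by (intro card_mono) auto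
  then have "2 * card (set xs \<inter> {z. z mod N = x mod N}) + 2 \<le> length xs"
    using assms(6) by (auto simp: card_insert_if split: if_splits)
  then show ?thesis using assms by (auto simp: extendable_def)
qed

section \<open>Short paths of odd length between nonadjacent vertices\<close>

lemma adj_spine: "x < 2 * t \<Longrightarrow> adj x (Suc x)"
  using mod_spine[of x] mod_spine[of "Suc x"] by (auto simp: adj_def link_def)

lemma good_path_single: "x \<in> V \<Longrightarrow> good_path x x [x]"
  by (simp add: good_path_def)

lemma good_path_append:
  assumes "good_path u a xs" and "good_path b v ys" and "adj a b" and "set xs \<inter> set ys = {}"
  shows "good_path u v (xs @ ys)"
  using assms by (simp add: good_path_def successively_append_iff)

lemma good_path_Cons:
  "u \<in> V \<Longrightarrow> adj u a \<Longrightarrow> u \<notin> set xs \<Longrightarrow> good_path a v xs \<Longrightarrow> good_path u v (u # xs)"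
  using good_path_append[OF good_path_single, of u a v xs] by simp

lemma good_path_snoc:
  "v \<in> V \<Longrightarrow> adj a v \<Longrightarrow> v \<notin> set xs \<Longrightarrow> good_path u a xs \<Longrightarrow> good_path u v (xs @ [v])"
  using good_path_append[OF _ good_path_single, of u a xs v] by simp

lemma spine_up:
  assumes "p \<le> q" and "q \<le> 2 * t"
  shows "good_path p q [p..<Suc q]"
  using assms(1,2)
proof (induction rule: dec_induct)
  case base
  then show ?case by (simp add: good_path_single spine_V)
next
  case (step q)
  have "good_path p (Suc q) ([p..<Suc q] @ [Suc q])"
    by (rule good_path_snoc[of _ q]) (use step in \<open>auto intro: spine_V adj_spine\<close>)
  then show ?case using step by simp
qed

lemma good_path_rev: "good_path u v xs \<Longrightarrow> good_path v u (rev xs)"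
proof -
  assume "good_path u v xs"
  moreover have "(\<lambda>x y. adj y x) = adj" by (intro ext) (rule adj_sym)
  ultimately show ?thesis by (simp only: good_path_def hd_rev last_rev successively_rev) simp
qed

lemma adj_closing: "adj 0 (2 * t)"
  by (simp add: adj_def closing_def)

text \<open>The direct way from \<open>p\<close> to \<open>q\<close> along the spine and this way
  through the closing edge together have \<open>N\<close> edges, an odd number, so exactly one of
  them has odd length.\<close>

lemma good_path_around:
  assumes "p < q" and "q \<le> 2 * t"
  shows "good_path p q (rev [0..<Suc p] @ rev [q..<Suc (2 * t)])"
  by (rule good_path_append[of _ 0 _ "2 * t"])
    (use assms in \<open>auto intro!: good_path_rev spine_up adj_closing simp del: upt_Suc\<close>)

text \<open>Ends of opposite parity are joined directly along the spine, ends of equal parity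
  through the closing edge. An end off the spine is attached to a neighbouring class. The longest
  path has \<open>2 * t + 4\<close> vertices, which is where \<open>k \<ge> t + 2\<close>
  enters.\<close>

lemma base_path:
  assumes V: "u \<in> V" "v \<in> V" and uv: "u \<noteq> v" "\<not> adj u v"
    and less: "u mod N < v mod N \<or> u mod N = v mod N \<and> u \<le> v"
  shows "\<exists>xs. good_path u v xs \<and> extendable xs"
proof -
  define p q where "p = u mod N" and "q = v mod N"
  have pq: "p \<le> q" "q \<le> 2 * t" using less mod_le by (auto simp: p_def q_def)
  have odd_adj: "adj x (x mod N - 1)" "adj x (x mod N + 1)" if "odd (x mod N)" for x
    using that mod_le[of x] mod_spine[of "x mod N - 1"] by (auto simp: adj_def link_def)
  have even_adj: "adj x y" "adj y x" if "even (x mod N)" "y mod N = x mod N + 1" for x y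
    using that by (auto simp: adj_def link_def)
  have umod: "u mod N = p" and vmod: "v mod N = q" by (simp_all add: p_def q_def)
  have spine: "x \<le> 2 * t \<longleftrightarrow> x = x mod N" for x
    using mod_spine[of x] mod_le[of x] by metis
  have spine_p: "u \<le> 2 * t \<longleftrightarrow> u = p" and spine_q: "v \<le> 2 * t \<longleftrightarrow> v = q"
    using spine[of u] spine[of v] by (simp_all add: p_def q_def)
  have p_lt: "p < 2 * t" if "u \<noteq> p"
    using that last_class[of u] V mod_le[of u] unfolding p_def by (metis le_neq_implies_less mod_spine order_refl)
  have q_lt: "q < 2 * t" if "v \<noteq> q"
    using that last_class[of v] V mod_le[of v] unfolding q_def by (metis le_neq_implies_less mod_spine order_refl)
  consider "odd p" "even q" | "even p" "odd q" | "odd p" "odd q" | "even p" "even q" by blast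
  then show ?thesis
  proof cases
    case 1
    then have "p < q" using pq by (metis le_neq_implies_less)
    have adj_u: "adj u (p + 1)" using odd_adj(2)[of u] 1 by (simp add: p_def)
    show ?thesis
    proof (cases "v = q")
      case True
      have "q \<noteq> p + 1" using uv True adj_u by auto
      then have "p + 3 \<le> q" using 1 \<open>p < q\<close> by presburger
      let ?xs = "u # [p + 1..<Suc q]"
      have "good_path (p + 1) q [p + 1..<Suc q]" by (rule spine_up) (use \<open>p < q\<close> pq in auto)
      then have "good_path u v ?xs"
        unfolding True using V(1) adj_u spine_p pq by (intro good_path_Cons) auto
      moreover have "extendable ?xs"
      proof (rule extendableI[of _ u u])
        show "even (length ?xs)" "length ?xs \<le> 2 * k" "u = u \<and> 4 \<le> length ?xs \<or> 6 \<le> length ?xs"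
          using 1 \<open>p + 3 \<le> q\<close> pq k by auto
        show "z \<in> {u, u}" if "z \<in> set ?xs" "z mod N = u mod N" for z
        proof (rule ccontr)
          assume "z \<notin> {u, u}"
          then have "p < z" "z \<le> 2 * t" using that(1) pq by auto
          then show False using that(2) umod mod_spine by simp
        qed
      qed (use umod vmod 1 in auto)
      ultimately show ?thesis by blast
    next
      case False
      then have q: "Suc q \<le> 2 * t" using q_lt by simp
      \<comment> \<open>Off the spine, \<open>v\<close> has neighbours only in the class of
        \<open>q + 1\<close>, so the path passes \<open>q\<close> and steps back to
        \<open>v\<close>.\<close>
      let ?xs = "u # [p + 1..<Suc (Suc q)] @ [v]"
      have "good_path (p + 1) (Suc q) [p + 1..<Suc (Suc q)]"
        by (rule spine_up) (use \<open>p < q\<close> q in auto)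
      moreover have "adj (Suc q) v" using even_adj(2)[of v "Suc q"] 1 mod_spine[OF q] by (simp add: q_def)
      ultimately have "good_path (p + 1) v ([p + 1..<Suc (Suc q)] @ [v])"
        using V(2) spine_q q False by (intro good_path_snoc) auto
      then have "good_path u v ?xs"
        using V(1) adj_u spine_p q uv by (intro good_path_Cons) auto
      moreover have "extendable ?xs"
      proof (rule extendableI[of _ u u])
        show "even (length ?xs)" "length ?xs \<le> 2 * k" "u = u \<and> 4 \<le> length ?xs \<or> 6 \<le> length ?xs"
          using 1 \<open>p < q\<close> q k by auto
        show "z \<in> {u, u}" if "z \<in> set ?xs" "z mod N = u mod N" for z
        proof (rule ccontr)
          assume "z \<notin> {u, u}"
          then have "z = v \<or> p < z \<and> z \<le> 2 * t" using that(1) q by auto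
          then show False using that(2) umod vmod mod_spine \<open>p < q\<close> by auto
        qed
      qed (use umod vmod 1 in auto)
      ultimately show ?thesis by blast
    qed
  next
    case 2
    have "p < q" using pq 2 by (metis le_neq_implies_less)
    have "q \<noteq> p + 1" using uv 2 even_adj(1)[of u v] by (auto simp: p_def q_def)
    then have "p + 3 \<le> q" using 2 \<open>p < q\<close> by presburger
    let ?xs = "u # [p + 1..<Suc (q - 1)] @ [v]"
    have p: "p + 1 \<le> 2 * t" using pq \<open>p < q\<close> by simp
    have "good_path (p + 1) (q - 1) [p + 1..<Suc (q - 1)]"
      by (rule spine_up) (use \<open>p + 3 \<le> q\<close> pq in auto)
    moreover have "adj (q - 1) v" using odd_adj(1)[of v] 2 adj_sym by (simp add: q_def)
    ultimately have "good_path (p + 1) v ([p + 1..<Suc (q - 1)] @ [v])"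
      using V(2) spine_q pq \<open>p < q\<close> by (intro good_path_snoc) auto
    moreover have "adj u (p + 1)" using even_adj(1)[of u "p + 1"] 2 mod_spine[OF p] by (simp add: p_def)
    ultimately have "good_path u v ?xs"
      using V(1) spine_p pq \<open>p < q\<close> uv by (intro good_path_Cons) auto
      moreover have "extendable ?xs"
      proof (rule extendableI[of _ v v])
        show "even (length ?xs)" "length ?xs \<le> 2 * k" "v = v \<and> 4 \<le> length ?xs \<or> 6 \<le> length ?xs"
          using 2 \<open>p + 3 \<le> q\<close> pq k by auto
        show "z \<in> {v, v}" if "z \<in> set ?xs" "z mod N = v mod N" for z
        proof (rule ccontr)
          assume "z \<notin> {v, v}"
          then have "z = u \<or> z < q" using that(1) by auto
          then show False using that(2) umod vmod mod_spine[of z] pq \<open>p < q\<close> by auto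
        qed
      qed (use umod vmod 2 in auto)
    ultimately show ?thesis by blast
  next
    case 3
    have "0 < p" using 3(1) by (rule odd_pos)
    have "q < 2 * t" using 3 pq by (metis even_mult_iff even_numeral le_neq_implies_less)
    let ?ys = "rev [0..<Suc (p - 1)] @ rev [q + 1..<Suc (2 * t)]"
    let ?xs = "u # ?ys @ [v]"
    have "good_path (p - 1) (q + 1) ?ys"
      by (rule good_path_around) (use pq \<open>q < 2 * t\<close> in auto)
    moreover have "adj (q + 1) v" using odd_adj(2)[of v] 3 adj_sym by (simp add: q_def)
    ultimately have "good_path (p - 1) v (?ys @ [v])"
      using V(2) spine_q pq \<open>0 < p\<close> by (intro good_path_snoc) auto
    moreover have "adj u (p - 1)" using odd_adj(1)[of u] 3 by (simp add: p_def)
    ultimately have "good_path u v ?xs"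
      using V(1) spine_p pq \<open>0 < p\<close> uv by (intro good_path_Cons) auto
    moreover have "extendable ?xs"
    \<comment> \<open>For \<open>p = q\<close> the odd class contains both ends. The path then has
      \<open>2 * t + 2\<close> vertices, at least the six required.\<close>
    proof (rule extendableI[of _ u "if p = q then v else u"])
      show "even (length ?xs)" "length ?xs \<le> 2 * k"
        using 3 pq \<open>0 < p\<close> \<open>q < 2 * t\<close> k by auto
      show "z \<in> {u, if p = q then v else u}" if "z \<in> set ?xs" "z mod N = u mod N" for z
      proof (rule ccontr)
        assume "z \<notin> {u, if p = q then v else u}"
        then have "z = v \<and> p \<noteq> q \<or> z < p \<or> p < z \<and> z \<le> 2 * t"
          using that(1) pq \<open>0 < p\<close> by (auto split: if_splits)
        then show False using that(2) umod vmod mod_spine[of z] pq by auto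
      qed
      show "u = (if p = q then v else u) \<and> 4 \<le> length ?xs \<or> 6 \<le> length ?xs"
        using 3 pq \<open>0 < p\<close> \<open>q < 2 * t\<close> t by auto
    qed (use 3 umod in auto)
    ultimately show ?thesis by blast
  next
    case 4
    \<comment> \<open>Within one even class the order \<open>u \<le> v\<close> ensures that
      \<open>v\<close> is not the spine vertex.\<close>
    have "p < q" if "v = q" using less that uv spine_p pq umod vmod by auto
    define ys where "ys = (if v = q then rev [0..<Suc p] @ rev [q..<Suc (2 * t)]
      else (rev [0..<Suc p] @ rev [q + 1..<Suc (2 * t)]) @ [v])"
    have path: "good_path p v ys"
    proof (cases "v = q")
      case True
      then show ?thesis
        using good_path_around[of p q] pq \<open>v = q \<Longrightarrow> p < q\<close> by (simp add: ys_def)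
    next
      case False
      then have q: "q + 1 \<le> 2 * t" using q_lt by simp
      have "adj (q + 1) v" using even_adj(2)[of v "q + 1"] 4 mod_spine[OF q] by (simp add: q_def)
      moreover have "good_path p (q + 1) (rev [0..<Suc p] @ rev [q + 1..<Suc (2 * t)])"
        by (rule good_path_around) (use pq q in auto)
      moreover have "v \<notin> set (rev [0..<Suc p] @ rev [q + 1..<Suc (2 * t)])"
        using spine_q False pq by auto
      ultimately show ?thesis
        using V(2) False unfolding ys_def by (simp only: if_False) (intro good_path_snoc)
    qed
    have len: "length ys = p + 2 * t + 2 - q"
      using pq q_lt by (cases "v = q") (auto simp: ys_def)
    have mem: "z = v \<or> z \<le> p \<or> q \<le> z \<and> z \<le> 2 * t" if "z \<in> set ys" for z
      using that by (auto simp: ys_def split: if_splits)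
    show ?thesis
    proof (cases "u = p")
      case True
      \<comment> \<open>The ends \<open>0\<close> and \<open>2 * t\<close> are adjacent, so one of
        the two arcs of the path has at least two edges and contains \<open>1\<close> or
        \<open>2 * t - 1\<close>.\<close>
      have "\<not> (p = 0 \<and> q = 2 * t)" using uv True adj_closing q_lt by auto
      then have inner: "p \<ge> 2 \<or> q + 2 \<le> 2 * t" using 4 pq by presburger
      define x where "x = (if p \<ge> 2 then 1 else 2 * t - 1)"
      have x: "x \<in> set ys" "odd x" "x \<le> 2 * t"
        using inner t by (auto simp: x_def ys_def)
      have "extendable ys"
      proof (rule extendableI[of _ x x])
        show "even (length ys)" "length ys \<le> 2 * k" "x = x \<and> 4 \<le> length ys \<or> 6 \<le> length ys"
          using len 4 pq inner k by auto
        show "z \<in> {x, x}" if "z \<in> set ys" "z mod N = x mod N" for z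
          using mem[OF that(1)] that(2) x mod_spine[of z] mod_spine[of x] vmod 4 pq by auto
      qed (use x mod_spine[of x] in auto)
      then show ?thesis using path True by blast
    next
      case False
      then have p: "p + 1 < 2 * t" using p_lt 4 by presburger
      then have "p + 1 < N" by (simp add: N_eq)
      \<comment> \<open>Off the spine, \<open>u\<close> needs a neighbour in the class of
        \<open>p + 1\<close>. The spine vertex \<open>p + 1\<close> may already lie on
        \<open>ys\<close> when \<open>p = q\<close>, so the next member of its class is
        taken.\<close>
      define w where "w = p + 1 + N"
      have w: "w mod N = p + 1" "w div N = 1" "w > 2 * t"
      proof -
        show "w mod N = p + 1" unfolding w_def mod_add_self2 using \<open>p + 1 < N\<close> by (rule mod_less)
        show "w div N = 1" unfolding w_def div_add_self2[OF N_pos[THEN gr_implies_not_zero]]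
          using \<open>p + 1 < N\<close> by simp
        show "w > 2 * t" by (simp add: w_def N_eq)
      qed
      have "w \<in> V" using odd_class[of w] w 4 k t by simp
      have notin: "w \<notin> set ys" "u \<notin> set ys" "u \<noteq> w"
        using mem w 4 umod vmod pq spine_p False uv by fastforce+
      let ?xs = "u # w # ys"
      have "adj w p" using odd_adj(1)[of w] w 4 by simp
      moreover have "adj u w" using even_adj(1)[of u w] w 4 umod by simp
      ultimately have "good_path u v ?xs"
        using V(1) \<open>w \<in> V\<close> notin path by (intro good_path_Cons[of _ w] good_path_Cons[of _ p]) auto
      moreover have "extendable ?xs"
      proof (rule extendableI[of _ w "if p = q then p + 1 else w"])
        show "even (length ?xs)" "length ?xs \<le> 2 * k"
          using len 4 pq k by auto
        show "w = (if p = q then p + 1 else w) \<and> 4 \<le> length ?xs \<or> 6 \<le> length ?xs"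
          using len pq t by auto
        show "z \<in> {w, if p = q then p + 1 else w}" if "z \<in> set ?xs" "z mod N = w mod N" for z
        proof -
          have "z mod N = p + 1" using that(2) w by simp
          then have "z \<noteq> u" "z \<noteq> v" using umod vmod 4 by auto
          then have "z = w \<or> z \<le> p \<or> q \<le> z \<and> z \<le> 2 * t" using mem that(1) by auto
          moreover have "p = q \<or> p + 2 \<le> q" using pq 4 by presburger
          ultimately show ?thesis using \<open>z mod N = p + 1\<close> mod_spine[of z] pq by auto
        qed
      qed (use w 4 in auto)
      ultimately show ?thesis by blast
    qed
  qed
qed

section \<open>Saturation of the closed chain\<close>

lemma saturated_chain: "saturated (cycle_graph (2 * k)) chain"
  unfolding saturated_def
proof (intro conjI ballI impI)
  show "\<not> contains_copy chain (cycle_graph (2 * k))" by (rule no_even_cycle)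
  fix u v assume "u \<in> verts chain" "v \<in> verts chain" "u \<noteq> v" "{u, v} \<notin> edges chain"
  then have V: "u \<in> V" "v \<in> V" and uv: "u \<noteq> v" "\<not> adj u v" "\<not> adj v u"
    using edge_iff adj_sym by (auto simp: chain_def)
  obtain u' v' xs where uv': "{u', v'} = {u, v}" and xs: "good_path u' v' xs" "length xs = 2 * k"
  proof (cases "u mod N < v mod N \<or> u mod N = v mod N \<and> u \<le> v")
    case True
    then show ?thesis using base_path[OF V uv(1,2)] extend_path that[of u v] by metis
  next
    case False
    then have "v mod N < u mod N \<or> v mod N = u mod N \<and> v \<le> u" by linarith
    then show ?thesis
      using base_path[OF V(2,1) uv(1)[symmetric] uv(3)] extend_path that[of v u]
      by (metis insert_commute)
  qed
  have "contains_copy (add_edge u v chain) (cycle_graph (length xs))"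
  proof (rule contains_copy_cycleI)
    show "successively (\<lambda>x y. {x, y} \<in> edges (add_edge u v chain)) xs"
    proof (rule successively_mono)
      show "successively adj xs" using xs by (simp add: good_path_def)
      show "{x, y} \<in> edges (add_edge u v chain)" if "x \<in> set xs" "y \<in> set xs" "adj x y" for x y
        using that xs edge_iff by (auto simp: add_edge_def good_path_def)
    qed
  qed (use xs k uv' in \<open>auto simp: good_path_def add_edge_def chain_def insert_commute\<close>)
  then show "contains_copy (add_edge u v chain) (cycle_graph (2 * k))" using xs by simp
qed

end

subsection \<open>Realising the number of vertices\<close>

text \<open>\<open>core\<close> collects the vertices that the locale forces, given in
  \<open>S\<close> as pairs of residue and quotient. The class of \<open>0\<close> has no upper
  bound and supplies the remaining ones.\<close>

lemma ex_closed_chain: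
  assumes "t \<ge> 3" and "k \<ge> t + 2" and "n \<ge> 3 * k * t"
  obtains V where "closed_chain t k V" and "card V = n"
proof -
  define N where "N = 2 * t + 1"
  have N: "N > 0" by (simp add: N_def)
  define S where "S = (\<lambda>i. 2 * i + 1) ` {..<t} \<times> {..<k - 1} \<union> (\<lambda>i. 2 * i) ` {..<t} \<times> {..<2 * k} \<union> {(2 * t, 0)}"
  define core where "core = (\<lambda>(p, j). p + j * N) ` S"
  have S: "finite S" "card S \<le> t * (k - 1) + t * (2 * k) + 1"
  proof -
    have "card ((\<lambda>i. 2 * i + 1) ` {..<t} \<times> {..<k - 1}) = t * (k - 1)"
      "card ((\<lambda>i. 2 * i) ` {..<t} \<times> {..<2 * k}) = t * (2 * k)"
      by (simp_all add: card_cartesian_product card_image inj_on_def)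
    then show "card S \<le> t * (k - 1) + t * (2 * k) + 1"
      unfolding S_def
      by (metis (no_types, lifting) add_mono card_Un_le card.empty card_insert_disjoint empty_iff finite.emptyI
          order.refl order.trans One_nat_def)
  qed (simp add: S_def)
  \<comment> \<open>The left side equals \<open>3 * k * t - t + 1\<close>.\<close>
  have "t * (k - 1) + t * (2 * k) + 1 \<le> 3 * k * t"
    using assms by (cases k) (auto simp: algebra_simps)
  then have "card core \<le> n"
    using S(2) card_image_le[OF S(1), of "\<lambda>(p, j). p + j * N"] assms(3) unfolding core_def by linarith
  with S(1) have core: "finite core" "card core \<le> n" by (simp_all add: core_def)
  have "infinite (range (\<lambda>j. j * N) - core)"
    using N core(1) by (intro Diff_infinite_finite range_inj_infinite) (auto simp: inj_on_def)
  then obtain Z where Z: "Z \<subseteq> range (\<lambda>j. j * N) - core" "finite Z" "card Z = n - card core"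
    by (meson infinite_arbitrarily_large)
  define V where "V = core \<union> Z"
  have "card V = n"
  proof -
    have "core \<inter> Z = {}" using Z(1) by blast
    then show ?thesis using card_Un_disjoint[OF core(1) Z(2)] Z(3) core(2) by (simp add: V_def)
  qed
  have S_iff: "(m, j) \<in> S \<longleftrightarrow>
      odd m \<and> m < 2 * t \<and> j < k - 1 \<or> even m \<and> m < 2 * t \<and> j < 2 * k \<or> m = 2 * t \<and> j = 0" for m j
  proof -
    have "m \<in> (\<lambda>i. 2 * i + 1) ` {..<t} \<longleftrightarrow> odd m \<and> m < 2 * t"
      by (auto elim: oddE)
    moreover have "m \<in> (\<lambda>i. 2 * i) ` {..<t} \<longleftrightarrow> even m \<and> m < 2 * t"
      by (auto elim: evenE)
    ultimately show ?thesis
      unfolding S_def Un_iff mem_Times_iff fst_conv snd_conv lessThan_iff by simp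
  qed
  have core_iff: "v \<in> core \<longleftrightarrow> (v mod N, v div N) \<in> S" for v
  proof
    assume "v \<in> core"
    then obtain p j where pj: "(p, j) \<in> S" "v = p + j * N" by (auto simp: core_def)
    have "p < N" using pj(1) unfolding S_iff N_def by linarith
    then show "(v mod N, v div N) \<in> S" using pj by simp
  next
    assume "(v mod N, v div N) \<in> S"
    then show "v \<in> core"
      unfolding core_def by (rule rev_image_eqI) simp
  qed
  have Z_mod: "v mod N = 0" if "v \<in> Z" for v using that Z(1) by auto
  have V_iff: "v \<in> V \<longleftrightarrow> (v mod N, v div N) \<in> S \<or> v \<in> Z" for v
    by (simp add: V_def core_iff)
  have le: "v mod N \<le> 2 * t" for v using mod_less_divisor[OF N, of v] by (simp add: N_def)
  have "closed_chain t k V"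
  proof (unfold_locales, fold N_def)
    show "finite V" using core(1) Z(2) by (simp add: V_def)
    show "v \<in> V \<longleftrightarrow> v div N < k - 1" if "odd (v mod N)" for v
    proof -
      have "v \<notin> Z" "v mod N \<noteq> 2 * t" using that Z_mod[of v] by auto
      then show ?thesis using that le[of v] unfolding V_iff S_iff by linarith
    qed
    show "v \<in> V" if "even (v mod N)" "v mod N < 2 * t" "v div N < 2 * k" for v
      using that unfolding V_iff S_iff by blast
    show "v \<in> V \<longleftrightarrow> v = 2 * t" if "v mod N = 2 * t" for v
    proof -
      have "v \<notin> Z" using that Z_mod[of v] assms(1) by auto
      then have "v \<in> V \<longleftrightarrow> v div N = 0" using that unfolding V_iff S_iff by simp
      also have "\<dots> \<longleftrightarrow> v = 2 * t"
      proof
        assume "v div N = 0"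
        then show "v = 2 * t" using that div_mult_mod_eq[of v N] by simp
      qed (simp add: N_def)
      finally show ?thesis .
    qed
  qed (use assms in auto)
  then show ?thesis using that \<open>card V = n\<close> by blast
qed

theorem theorem1p3:
  fixes r k n :: nat
  assumes "odd r" and "r \<ge> 5" and "2 * k \<ge> r + 5" and "n \<ge> 2 * k * r"
  shows "sat n (cycle_graph r) (cycle_graph (2 * k)) = 0 \<and>
         (\<exists>G :: nat ugraph. simple_graph G \<and> card (verts G) = n \<and>
            saturated (cycle_graph (2 * k)) G \<and> \<not> contains_copy G (cycle_graph r))"
proof -
  \<comment> \<open>Then \<open>N = r + 2\<close>, and \<open>2 * k \<ge> r + 5\<close> becomes
    \<open>k \<ge> t + 2\<close>.\<close>
  define t where "t = (r + 1) div 2"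
  have r: "r = 2 * t - 1" and t: "t \<ge> 3" "k \<ge> t + 2"
    using assms(1-3) unfolding t_def by presburger+
  have "3 * t \<le> 2 * r" using r t by simp
  then have "k * (3 * t) \<le> k * (2 * r)" by (rule mult_le_mono2)
  then have "n \<ge> 3 * k * t" using assms(4) by (simp only: ac_simps)
  then obtain V where V: "closed_chain t k V" "card V = n"
    using ex_closed_chain t by blast
  interpret closed_chain t k "2 * t + 1" V
    by (fact V(1))
  have G: "simple_graph chain" "card (verts chain) = n" "saturated (cycle_graph (2 * k)) chain"
    and free: "\<not> contains_copy chain (cycle_graph r)"
    using simple_chain saturated_chain no_short_odd_cycle V(2) r by (auto simp: chain_def)
  have "copies (cycle_graph r) chain = {}"
    using free by (auto simp: copies_def contains_copy_def)
  \<comment> \<open>The value \<open>0\<close> is the cardinality of the empty set of copies, not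
    the default of \<open>card\<close> on infinite sets.\<close>
  then have "enat 0 \<in> {enat (card (copies (cycle_graph r) G)) | G :: nat ugraph.
      simple_graph G \<and> card (verts G) = n \<and> saturated (cycle_graph (2 * k)) G}"
    using G by (metis (mono_tags, lifting) card.empty mem_Collect_eq)
  then have "sat n (cycle_graph r) (cycle_graph (2 * k)) \<le> enat 0"
    unfolding sat_def by (rule Inf_lower)
  then have "sat n (cycle_graph r) (cycle_graph (2 * k)) = 0" by (simp add: zero_enat_def[symmetric])
  then show ?thesis using G free by blast
qed

end
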